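(* Let $p$ be a prime and let $A,B\in\overline{\mathbb Q}[x]$ both be not identically zero. Suppose that $f,g\in\mathcal A(\mathbb C_p)$ satisfy $$A(x)f^2(x)+B(x)g^2(x)=1$$ and $g(0)\neq 0$. If $f^{(i)}(0)\in\overline{\mathbb Q}$ for all integers $i$ with $0\leq i\leq \frac{\deg A+\deg B}{2}-1$, and $g^{(i)}(0)\in\overline{\mathbb Q}$ for all integers $i$ with $0\leq i<\frac{\deg A+\deg B}{2}-1$, then $f,g\in\mathbb C_p[x]$.
   Context: $\mathbb C_p$ is the field of complex $p$-adic numbers (the completion of an algebraic closure of $\mathbb Q_p$), and $\overline{\mathbb Q}\subset\mathbb C_p$ is the algebraic closure of $\mathbb Q$ in $\mathbb C_p$. $\mathcal A(\mathbb C_p)$ is the ring of entire functions on $\mathbb C_p$, i.e. power series $\sum_{i\ge 0}c_ix^i$ with $c_i\in\mathbb C_p$ that converge on all of $\mathbb C_p$ (equivalently, either only finitely many $c_i$ are nonzero, or $\lim_{n\to\infty}(\mathrm{ord}_p(c_n)-\lambda n)=\infty$ for every $\lambda\in\mathbb R$). $f^{(i)}$ denotes the $i$-th derivative. *)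

theory Defs
  imports "HOL-Analysis.Analysis" "HOL-Computational_Algebra.Computational_Algebra"
begin

text \<open>
  A field of characteristic 0 with an absolute value, carrying the metric and topology it induces;
  the triangle inequality and definiteness of \<open>abs_val\<close> come from \<open>metric_space\<close>.
  The library's \<open>norm\<close> is tied to real normed vector spaces, and a field with a \<open>p\<close>-adic
  absolute value is not one.
\<close>

class valued_field_char_0 = field_char_0 + metric_space +
  fixes abs_val :: "'a \<Rightarrow> real"
  assumes dist_abs_val: "dist x y = abs_val (x - y)"
    and abs_val_mult: "abs_val (x * y) = abs_val x * abs_val y"

definition padic_ord :: "nat \<Rightarrow> rat \<Rightarrow> int" where
  "padic_ord p r = int (multiplicity (int p) (fst (quotient_of r)))
                 - int (multiplicity (int p) (snd (quotient_of r)))"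

definition padic_abs :: "nat \<Rightarrow> rat \<Rightarrow> real" where
  "padic_abs p r = (if r = 0 then 0 else real p powi (- padic_ord p r))"

text \<open>
  Inside a fixed valued field, \<open>K\<close> is a completion of \<open>F\<close> with respect to the
  restricted absolute value.
\<close>

definition completion_of :: "'a::metric_space set \<Rightarrow> 'a set \<Rightarrow> bool" where
  "completion_of K F \<longleftrightarrow> F \<subseteq> K \<and> complete K \<and> K \<subseteq> closure F"

definition is_subfield :: "'a::field set \<Rightarrow> bool" where
  "is_subfield K \<longleftrightarrow> 0 \<in> K \<and> 1 \<in> K \<and>
     (\<forall>x\<in>K. \<forall>y\<in>K. x + y \<in> K \<and> x * y \<in> K) \<and> (\<forall>x\<in>K. - x \<in> K \<and> inverse x \<in> K)"

definition poly_over :: "'a::zero set \<Rightarrow> 'a poly \<Rightarrow> bool" where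
  "poly_over K q \<longleftrightarrow> (\<forall>i. coeff q i \<in> K)"

definition algebraic_closure_of :: "'a::field set \<Rightarrow> 'a set \<Rightarrow> bool" where
  "algebraic_closure_of L F \<longleftrightarrow> is_subfield F \<and> is_subfield L \<and> F \<subseteq> L \<and>
     (\<forall>x\<in>L. \<exists>q. poly_over F q \<and> q \<noteq> 0 \<and> poly q x = 0) \<and>
     (\<forall>q. poly_over L q \<and> degree q > 0 \<longrightarrow> (\<exists>x\<in>L. poly q x = 0))"

text \<open>
  The type \<open>'a\<close> is a model of the field of complex \<open>p\<close>-adic numbers: its absolute
  value extends the \<open>p\<close>-adic one, and it is the completion of an algebraic closure \<open>L\<close>
  of a completion \<open>Qp\<close> of the rationals.  These data are unique up to isometric isomorphism.
\<close>

definition is_complex_padics :: "'a::valued_field_char_0 itself \<Rightarrow> nat \<Rightarrow> bool" where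
  "is_complex_padics T p \<longleftrightarrow>
     (\<forall>r. abs_val (of_rat r :: 'a) = padic_abs p r) \<and>
     (\<exists>Qp L :: 'a set. completion_of Qp \<rat> \<and> algebraic_closure_of L Qp \<and> completion_of UNIV L)"

text \<open>
  An entire function is identified with its power series at 0.  The library's radius of
  convergence \<open>fps_conv_radius\<close> is only available over real normed fields.
\<close>

definition entire_fps :: "'a::valued_field_char_0 fps \<Rightarrow> bool" where
  "entire_fps f \<longleftrightarrow> (\<forall>x. summable (\<lambda>n. fps_nth f n * x ^ n))"

end

theory Submission
  imports Defs
begin

text \<open>
  Multiplying the equation \<open>A f\<^sup>2 + B g\<^sup>2 = 1\<close> by \<open>A\<close> gives the Pell equation
  \<open>P\<^sup>2 - D g\<^sup>2 = A\<close> with \<open>P = A f\<close> and \<open>D = - A B\<close>.  Formally it factors as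
  \<open>(P + \<surd>D g) (P - \<surd>D g) = A\<close>.  If \<open>D\<close> has even degree, its square root converges outside a
  large disc, and there both factors are analytic.  The logarithm of the Gauss norm of an analytic function
  is a convex function of the logarithm of the radius.  Outside a large disc the product \<open>A\<close> has an
  affine one, so two convex functions have an affine sum and are affine themselves.  This says that both
  factors grow like powers of the radius; their sum \<open>2 P\<close> then has polynomial growth, so \<open>P\<close> is a
  polynomial, and so is its quotient \<open>f\<close> by \<open>A\<close>.  If \<open>D\<close> has odd degree, the slopes of the
  convex functions attached to \<open>P\<^sup>2\<close> and \<open>D g\<^sup>2\<close> have different parities, so neither side can
  cancel the other and \<open>P\<^sup>2\<close> is no larger than \<open>A\<close>.  The equation is symmetric in \<open>f\<close> and
  \<open>g\<close>, which gives the claim for \<open>g\<close>.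

  Two devices keep the argument inside formal power series.  Slopes are represented by the dominant index,
  the largest index of a term attaining the Gauss norm: it is additive on products
  (\<open>dominant_index_mult\<close>), increases with the radius (\<open>dominant_index_mono\<close>) and is stable
  under small perturbations (\<open>dominant_index_add\<close>).  And instead of Laurent series at infinity,
  \<open>\<surd>D\<close> is replaced by \<open>x\<^sup>-\<^sup>N Q\<close> with a polynomial \<open>Q\<close> such that \<open>Q\<^sup>2\<close> is as close to
  \<open>x\<^sup>2\<^sup>N D\<close> as desired (\<open>approximate_sqrt\<close>); the square root of the leading coefficient of
  \<open>D\<close> is approximated too, from the dense algebraic closure of the \<open>p\<close>-adic numbers.  The growth
  estimate for \<open>P\<close> (\<open>pell_polynomial_even\<close>) does not depend on the quality of the approximation,
  which may therefore be chosen for each radius separately.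
\<close>

section \<open>Non-archimedean absolute values\<close>

lemma mult_less_mult_if_less:
  fixes a b F G :: real
  assumes "a < F \<or> b < G" "a \<le> F" "b \<le> G" "0 \<le> a" "0 \<le> b" "0 < F" "0 < G"
  shows "a * b < F * G"
  using assms(1)
proof
  assume "a < F"
  then have "a * b \<le> a * G" "a * G < F * G"
    using assms by (auto intro: mult_left_mono)
  then show ?thesis by linarith
next
  assume "b < G"
  then have "a * b \<le> F * b" "F * b < F * G"
    using assms by (auto intro: mult_right_mono)
  then show ?thesis by linarith
qed

locale nonarchimedean_absolute_value =
  fixes v :: "'a::field_char_0 \<Rightarrow> real"
  assumes v_eq_0_iff [simp]: "v x = 0 \<longleftrightarrow> x = 0"
    and v_nonneg [simp]: "v x \<ge> 0"
    and v_mult: "v (x * y) = v x * v y"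
    and v_add_le_max: "v (x + y) \<le> max (v x) (v y)"
begin

lemma v_0 [simp]: "v 0 = 0"
  by simp

lemma v_pos_iff [simp]: "v x > 0 \<longleftrightarrow> x \<noteq> 0"
  using v_nonneg[of x] v_eq_0_iff[of x] by linarith

lemma v_1 [simp]: "v 1 = 1"
proof -
  have "v 1 * v 1 = v 1 * 1"
    by (simp flip: v_mult)
  then show ?thesis
    by (subst (asm) mult_cancel_left) simp
qed

lemma v_power: "v (x ^ n) = v x ^ n"
  by (induction n) (simp_all add: v_mult)

lemma v_minus [simp]: "v (- x) = v x"
proof -
  have "v (-1) ^ 2 = 1 ^ 2"
    by (simp flip: v_power)
  then have "v (-1) = 1"
    by (subst (asm) power2_eq_iff_nonneg) simp_all
  then show ?thesis
    using v_mult[of "-1" x] by simp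
qed

lemma v_diff_le_max: "v (x - y) \<le> max (v x) (v y)"
  using v_add_le_max[of x "- y"] by simp

lemma v_sum_le:
  assumes "\<And>i. i \<in> I \<Longrightarrow> v (f i) \<le> M" and "0 \<le> M"
  shows "v (sum f I) \<le> M"
  using assms
proof (induction I rule: infinite_finite_induct)
  case (insert i I)
  then show ?case
    using v_add_le_max[of "f i" "sum f I"] by fastforce
qed simp_all

lemma v_sum_less:
  assumes "\<And>i. i \<in> I \<Longrightarrow> v (f i) < M" and "0 < M"
  shows "v (sum f I) < M"
  using assms
proof (induction I rule: infinite_finite_induct)
  case (insert i I)
  then show ?case
    using v_add_le_max[of "f i" "sum f I"] by fastforce
qed simp_all

lemma v_of_nat_le_1: "v (of_nat n) \<le> 1"
  using v_sum_le[of "{..<n}" "\<lambda>_. 1" 1] by simp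

lemma v_add_eq_left:
  assumes "v y < v x"
  shows "v (x + y) = v x"
proof -
  have "v x \<le> max (v (x + y)) (v y)"
    using v_diff_le_max[of "x + y" y] by simp
  then show ?thesis
    using v_add_le_max[of x y] assms by linarith
qed

section \<open>Gauss norms and dominant indices of entire series\<close>

text \<open>
  Boundedness at every radius forces \<open>v (f\<^sub>n) r\<^sup>n\<close> to tend to \<open>0\<close> at every radius, as one sees by
  comparing with the radius \<open>2 r\<close>; so this is convergence on the whole field, but in a form that passes
  to products by a single estimate.
\<close>

definition entire_series :: "'a fps \<Rightarrow> bool" where
  "entire_series f \<longleftrightarrow> (\<forall>r>0. \<exists>M. \<forall>n. v (fps_nth f n) * r ^ n \<le> M)"

definition gauss_norm :: "real \<Rightarrow> 'a fps \<Rightarrow> real" where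
  "gauss_norm r f = (SUP n. v (fps_nth f n) * r ^ n)"

text \<open>
  This is the largest index at which the Gauss norm is attained.  By the theory of Newton polygons it
  counts, over a complete and algebraically closed field, the zeros in the closed disc of radius
  \<open>r\<close>, and it is the right-hand slope of
  \<open>log r \<mapsto> log (gauss_norm r f)\<close>.
\<close>

definition dominant_index :: "real \<Rightarrow> 'a fps \<Rightarrow> nat \<Rightarrow> bool" where
  "dominant_index r f n \<longleftrightarrow> fps_nth f n \<noteq> 0 \<and>
     (\<forall>k. v (fps_nth f k) * r ^ k \<le> v (fps_nth f n) * r ^ n) \<and>
     (\<forall>k>n. v (fps_nth f k) * r ^ k < v (fps_nth f n) * r ^ n)"

lemma coeff_le_gauss_norm:
  assumes "entire_series f" and "r > 0"
  shows "v (fps_nth f k) * r ^ k \<le> gauss_norm r f"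
  unfolding gauss_norm_def
  using assms unfolding entire_series_def
  by (intro cSUP_upper) (auto simp: bdd_above_def)

lemma gauss_norm_le:
  assumes "\<And>k. v (fps_nth f k) * r ^ k \<le> M"
  shows "gauss_norm r f \<le> M"
  unfolding gauss_norm_def by (intro cSUP_least assms) auto

lemma gauss_norm_nonneg:
  assumes "entire_series f" and "r > 0"
  shows "gauss_norm r f \<ge> 0"
  using coeff_le_gauss_norm[OF assms, of 0] order_trans[OF v_nonneg] by simp

lemma gauss_norm_eq_dominant:
  assumes "dominant_index r f n"
  shows "gauss_norm r f = v (fps_nth f n) * r ^ n"
  unfolding gauss_norm_def
  using assms by (intro cSup_eq_maximum) (auto simp: dominant_index_def)

lemma gauss_norm_0 [simp]: "gauss_norm r 0 = 0"
  by (simp add: gauss_norm_def)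

lemma coeff_add_le_max:
  assumes "r > 0"
  shows "v (fps_nth (f + g) k) * r ^ k
    \<le> max (v (fps_nth f k) * r ^ k) (v (fps_nth g k) * r ^ k)"
proof -
  have "v (fps_nth (f + g) k) * r ^ k \<le> max (v (fps_nth f k)) (v (fps_nth g k)) * r ^ k"
    using v_add_le_max assms by (intro mult_right_mono) auto
  then show ?thesis
    using assms by (simp add: max_mult_distrib_right)
qed

lemma gauss_norm_add_le:
  assumes "entire_series f" "entire_series g" "r > 0"
  shows "gauss_norm r (f + g) \<le> max (gauss_norm r f) (gauss_norm r g)"
proof (rule gauss_norm_le)
  fix k
  have "v (fps_nth (f + g) k) * r ^ k \<le> max (v (fps_nth f k) * r ^ k) (v (fps_nth g k) * r ^ k)"
    using assms(3) by (rule coeff_add_le_max)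
  also have "\<dots> \<le> max (gauss_norm r f) (gauss_norm r g)"
    using assms by (intro max.mono coeff_le_gauss_norm)
  finally show "v (fps_nth (f + g) k) * r ^ k \<le> max (gauss_norm r f) (gauss_norm r g)" .
qed

lemma gauss_norm_minus [simp]: "gauss_norm r (- f) = gauss_norm r f"
  by (simp add: gauss_norm_def)

lemma entire_series_add:
  assumes "entire_series f" "entire_series g"
  shows "entire_series (f + g)"
  unfolding entire_series_def
proof (intro allI impI)
  fix r :: real
  assume r: "r > 0"
  have "v (fps_nth (f + g) k) * r ^ k \<le> max (gauss_norm r f) (gauss_norm r g)" for k
  proof -
    have "v (fps_nth (f + g) k) * r ^ k \<le> max (v (fps_nth f k) * r ^ k) (v (fps_nth g k) * r ^ k)"
      using r by (rule coeff_add_le_max)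
    also have "\<dots> \<le> max (gauss_norm r f) (gauss_norm r g)"
      using assms r by (intro max.mono coeff_le_gauss_norm)
    finally show ?thesis .
  qed
  then show "\<exists>M. \<forall>n. v (fps_nth (f + g) n) * r ^ n \<le> M" by blast
qed

lemma entire_series_minus: "entire_series f \<Longrightarrow> entire_series (- f)"
  by (simp add: entire_series_def)

lemma entire_series_diff:
  "entire_series f \<Longrightarrow> entire_series g \<Longrightarrow> entire_series (f - g)"
  using entire_series_add[of f "- g"] entire_series_minus[of g] by simp

lemma v_mult_nth_le:
  assumes f: "\<And>k. v (fps_nth f k) * r ^ k \<le> F" and g: "\<And>k. v (fps_nth g k) * r ^ k \<le> G"
    and r: "r > 0"
  shows "v (fps_nth (f * g) k) * r ^ k \<le> F * G"
proof -
  have nonneg: "F \<ge> 0" "G \<ge> 0"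
    using f[of 0] g[of 0] order_trans[OF v_nonneg] by auto
  have "v (fps_nth f i * fps_nth g (k - i)) \<le> F * G / r ^ k" if "i \<in> {0..k}" for i
  proof -
    have "(v (fps_nth f i) * r ^ i) * (v (fps_nth g (k - i)) * r ^ (k - i)) \<le> F * G"
      using f g nonneg r by (intro mult_mono) auto
    moreover have "(v (fps_nth f i) * r ^ i) * (v (fps_nth g (k - i)) * r ^ (k - i))
        = v (fps_nth f i * fps_nth g (k - i)) * r ^ (i + (k - i))"
      by (simp add: v_mult power_add)
    ultimately show ?thesis
      using that r by (simp add: field_simps)
  qed
  then have "v (fps_nth (f * g) k) \<le> F * G / r ^ k"
    unfolding fps_mult_nth using nonneg r by (intro v_sum_le) auto
  then show ?thesis
    using r by (simp add: field_simps)
qed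

lemma entire_series_mult:
  assumes "entire_series f" "entire_series g"
  shows "entire_series (f * g)"
  unfolding entire_series_def
  using v_mult_nth_le[OF coeff_le_gauss_norm coeff_le_gauss_norm] assms by blast

lemma entire_series_poly [simp]: "entire_series (fps_of_poly A)"
  unfolding entire_series_def
proof (intro allI impI)
  fix r :: real
  assume r: "r > 0"
  have "v (coeff A n) * r ^ n \<le> (\<Sum>i\<le>degree A. v (coeff A i) * r ^ i)" for n
  proof (cases "n \<le> degree A")
    case True
    then show ?thesis
      using r by (intro member_le_sum) auto
  next
    case False
    then show ?thesis
      using r by (auto simp: coeff_eq_0 intro!: sum_nonneg)
  qed
  then show "\<exists>M. \<forall>n. v (fps_nth (fps_of_poly A) n) * r ^ n \<le> M"
    by auto
qed

text \<open>
  Boundedness at the radius \<open>2 r\<close> makes all terms of large index smaller than a given nonzero one, so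
  that the supremum is a maximum over finitely many indices.
\<close>

lemma dominant_index_exists:
  assumes f: "entire_series f" "f \<noteq> 0" and r: "r > 0"
  obtains n where "dominant_index r f n"
proof -
  define w where "w k = v (fps_nth f k) * r ^ k" for k
  obtain M where M: "\<And>n. v (fps_nth f n) * (2 * r) ^ n \<le> M"
    using f(1) r unfolding entire_series_def by (metis mult_pos_pos zero_less_numeral)
  obtain j where j: "fps_nth f j \<noteq> 0"
    using f(2) by (metis fps_nonzero_nth)
  have wj: "w j > 0"
    using j r by (simp add: w_def)
  obtain N where N: "M / w j < 2 ^ N"
    using real_arch_pow[of 2 "M / w j"] by auto
  have tail: "w k < w j" if "k \<ge> N" for k
  proof -
    have "w k * 2 ^ k \<le> M"
      using M[of k] by (simp add: w_def power_mult_distrib ac_simps)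
    also have "M < w j * 2 ^ N"
      using N wj by (simp add: field_simps)
    also have "\<dots> \<le> w j * 2 ^ k"
      using that wj by (intro mult_left_mono power_increasing) auto
    finally show ?thesis by simp
  qed
  define W where "W = Max (w ` {..max N j})"
  have W_ge: "w k \<le> W" for k
  proof (cases "k \<le> max N j")
    case True
    then show ?thesis unfolding W_def by (intro Max_ge) auto
  next
    case False
    have "w j \<le> W" unfolding W_def by (intro Max_ge) auto
    then show ?thesis using tail[of k] False by force
  qed
  define S where "S = {k. w k = W}"
  have "W \<in> w ` {..max N j}"
    unfolding W_def by (intro Max_in) auto
  then have "S \<noteq> {}"
    by (auto simp: S_def)
  moreover have "S \<subseteq> {..N}"
    unfolding S_def using tail W_ge[of j] by (metis (mono_tags, lifting)
        atMost_iff linorder_linear mem_Collect_eq not_less subsetI)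
  then have fin: "finite S"
    using finite_subset by blast
  ultimately have "Max S \<in> S" by (intro Max_in)
  then have n: "w (Max S) = W"
    by (simp add: S_def)
  have "w k < W" if "k > Max S" for k
  proof -
    have "k \<notin> S"
      using that Max_ge[OF fin, of k] by auto
    then show ?thesis
      using W_ge[of k] by (simp add: S_def)
  qed
  moreover have "fps_nth f (Max S) \<noteq> 0"
    using n W_ge[of j] wj by (auto simp: w_def)
  ultimately have "dominant_index r f (Max S)"
    using n W_ge unfolding dominant_index_def w_def by auto
  then show thesis ..
qed

lemma dominant_index_unique:
  assumes "dominant_index r f n" "dominant_index r f m"
  shows "n = m"
  using assms unfolding dominant_index_def by (metis linorder_neqE_nat not_less)

text \<open>
  The slopes of a Newton polygon increase: passing to a larger radius favours the terms of larger index.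
\<close>

lemma dominant_index_mono:
  assumes n: "dominant_index r f n" and m: "dominant_index s f m" and rs: "0 < r" "r \<le> s"
  shows "n \<le> m"
proof (rule ccontr)
  assume "\<not> n \<le> m"
  then have "m < n" by simp
  have "v (fps_nth f m) * r ^ m * s ^ n \<le> v (fps_nth f n) * r ^ n * s ^ n"
    using n rs by (intro mult_right_mono) (auto simp: dominant_index_def)
  also have "\<dots> < v (fps_nth f m) * s ^ m * r ^ n"
    using m \<open>m < n\<close> rs by (auto simp: dominant_index_def field_simps)
  finally have "r ^ m * s ^ n < s ^ m * r ^ n"
    using m by (auto simp: dominant_index_def ac_simps)
  moreover have "r ^ n = r ^ m * r ^ (n - m)" "s ^ n = s ^ m * s ^ (n - m)"
    using \<open>m < n\<close> by (simp_all flip: power_add)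
  ultimately have "s ^ (n - m) < r ^ (n - m)"
    using rs by auto
  then show False
    using power_mono[of r s "n - m"] rs by simp
qed

text \<open>
  In the coefficient of index \<open>n + m\<close> of the product every summand other than
  \<open>f\<^sub>n g\<^sub>m\<close> involves an index beyond \<open>n\<close> or beyond \<open>m\<close> and is therefore strictly smaller, so the
  ultrametric inequality leaves the absolute value of that one summand.
\<close>

lemma dominant_index_mult:
  assumes n: "dominant_index r f n" and m: "dominant_index r g m" and r: "r > 0"
  shows "dominant_index r (f * g) (n + m)"
    and "v (fps_nth (f * g) (n + m)) = v (fps_nth f n) * v (fps_nth g m)"
proof -
  define F where "F = v (fps_nth f n) * r ^ n"
  define G where "G = v (fps_nth g m) * r ^ m"
  have pos: "F > 0" "G > 0"
    using n m r by (auto simp: F_def G_def dominant_index_def)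
  have strict: "v (fps_nth f i * fps_nth g (k - i)) < F * G / r ^ k"
    if "i \<le> k" "i > n \<or> k - i > m" for i k
  proof -
    have le: "v (fps_nth f i) * r ^ i \<le> F" "v (fps_nth g (k - i)) * r ^ (k - i) \<le> G"
      using n m by (auto simp: F_def G_def dominant_index_def)
    have "v (fps_nth f i) * r ^ i < F \<or> v (fps_nth g (k - i)) * r ^ (k - i) < G"
      using n m that(2) by (auto simp: F_def G_def dominant_index_def)
    then have "(v (fps_nth f i) * r ^ i) * (v (fps_nth g (k - i)) * r ^ (k - i)) < F * G"
      using le pos r by (intro mult_less_mult_if_less) auto
    moreover have "(v (fps_nth f i) * r ^ i) * (v (fps_nth g (k - i)) * r ^ (k - i))
        = v (fps_nth f i * fps_nth g (k - i)) * r ^ (i + (k - i))"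
      by (simp add: v_mult power_add)
    ultimately show ?thesis
      using that r by (simp add: field_simps)
  qed
  have split: "fps_nth (f * g) (n + m) = fps_nth f n * fps_nth g m
      + (\<Sum>i\<in>{0..n+m} - {n}. fps_nth f i * fps_nth g (n + m - i))"
    unfolding fps_mult_nth by (subst sum.remove[of _ n]) auto
  have "v (\<Sum>i\<in>{0..n+m} - {n}. fps_nth f i * fps_nth g (n + m - i)) < F * G / r ^ (n + m)"
    using pos r by (intro v_sum_less strict) auto
  also have "F * G / r ^ (n + m) = v (fps_nth f n * fps_nth g m)"
    using r by (simp add: F_def G_def v_mult power_add)
  finally have "v (fps_nth (f * g) (n + m)) = v (fps_nth f n * fps_nth g m)"
    unfolding split by (rule v_add_eq_left)
  then show eq: "v (fps_nth (f * g) (n + m)) = v (fps_nth f n) * v (fps_nth g m)"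
    by (simp add: v_mult)
  have val: "v (fps_nth (f * g) (n + m)) * r ^ (n + m) = F * G"
    by (simp add: eq F_def G_def power_add)
  have "v (fps_nth (f * g) k) * r ^ k \<le> F * G" for k
    using n m r by (intro v_mult_nth_le) (auto simp: F_def G_def dominant_index_def)
  moreover have "v (fps_nth (f * g) k) * r ^ k < F * G" if "k > n + m" for k
  proof -
    have "v (fps_nth (f * g) k) < F * G / r ^ k"
      unfolding fps_mult_nth using pos r that by (intro v_sum_less strict) auto
    then show ?thesis
      using r by (simp add: field_simps)
  qed
  moreover have "fps_nth (f * g) (n + m) \<noteq> 0"
    using val pos by auto
  ultimately show "dominant_index r (f * g) (n + m)"
    unfolding dominant_index_def val by blast
qed

lemma dominant_index_fps_X_power: "r > 0 \<Longrightarrow> dominant_index r (fps_X ^ n) n"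
  by (auto simp: dominant_index_def fps_X_power_nth)

lemma gauss_norm_mult:
  assumes "entire_series f" "entire_series g" "r > 0"
  shows "gauss_norm r (f * g) = gauss_norm r f * gauss_norm r g"
proof (cases "f = 0 \<or> g = 0")
  case False
  then obtain n m where nm: "dominant_index r f n" "dominant_index r g m"
    using dominant_index_exists assms by metis
  show ?thesis
    using dominant_index_mult[OF nm assms(3)] nm
    by (simp add: gauss_norm_eq_dominant power_add)
qed auto

text \<open>
  A perturbation smaller than the dominant term changes neither the dominant index nor the absolute value
  of its coefficient.
\<close>

lemma dominant_index_add:
  assumes n: "dominant_index r f n"
    and e: "\<And>k. v (fps_nth e k) * r ^ k < v (fps_nth f n) * r ^ n" and r: "r > 0"
  shows "dominant_index r (f + e) n" and "v (fps_nth (f + e) n) = v (fps_nth f n)"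
proof -
  have "v (fps_nth e n) < v (fps_nth f n)"
    using e[of n] r by simp
  then show eq: "v (fps_nth (f + e) n) = v (fps_nth f n)"
    by (simp add: v_add_eq_left)
  note max = coeff_add_le_max[OF r, of f e]
  have "v (fps_nth (f + e) k) * r ^ k \<le> v (fps_nth f n) * r ^ n" for k
    using max[of k] e[of k] n by (auto simp: dominant_index_def intro: order_trans)
  moreover have "v (fps_nth (f + e) k) * r ^ k < v (fps_nth f n) * r ^ n" if "k > n" for k
    using max[of k] e[of k] n that by (auto simp: dominant_index_def intro: le_less_trans)
  moreover have "fps_nth (f + e) n \<noteq> 0"
    using n eq by (metis dominant_index_def v_eq_0_iff)
  ultimately show "dominant_index r (f + e) n"
    unfolding dominant_index_def eq by blast
qed

section \<open>Criteria for an entire series to be a polynomial\<close>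

text \<open>
  The non-archimedean Liouville theorem; it is immediate from the coefficientwise definition of the norm.
\<close>

lemma polynomial_if_growth:
  assumes "\<And>r k. r \<ge> R \<Longrightarrow> v (fps_nth h k) * r ^ k \<le> C * r ^ K"
  shows "h \<in> range fps_of_poly"
proof -
  have "fps_nth h k = 0" if "k > K" for k
  proof (rule ccontr)
    assume nz: "fps_nth h k \<noteq> 0"
    define r where "r = max (max R 1) (\<bar>C\<bar> / v (fps_nth h k) + 1)"
    have r: "r \<ge> 1" "r \<ge> R" "r > \<bar>C\<bar> / v (fps_nth h k)"
      unfolding r_def by linarith+
    have "r * r ^ K \<le> r ^ k"
      using r(1) that by (metis Suc_leI power_Suc power_increasing)
    then have "v (fps_nth h k) * (r * r ^ K) \<le> v (fps_nth h k) * r ^ k"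
      by (intro mult_left_mono) auto
    also have "\<dots> \<le> C * r ^ K"
      using assms r by blast
    finally have "v (fps_nth h k) * r \<le> C"
      using r(1) by (simp flip: mult.assoc)
    moreover have "\<bar>C\<bar> < v (fps_nth h k) * r"
      using r(3) nz by (simp add: field_simps)
    ultimately show False by linarith
  qed
  then have "h = fps_of_poly (truncate_fps (Suc K) h)"
    by (intro fps_ext) (auto simp: fps_of_poly_truncate not_less)
  then show ?thesis by blast
qed

lemma gauss_norm_poly_le:
  assumes "r \<ge> 1"
  shows "gauss_norm r (fps_of_poly A) \<le> (\<Sum>i\<le>degree A. v (coeff A i)) * r ^ degree A"
proof (rule gauss_norm_le)
  fix k
  show "v (fps_nth (fps_of_poly A) k) * r ^ k \<le> (\<Sum>i\<le>degree A. v (coeff A i)) * r ^ degree A"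
  proof (cases "k \<le> degree A")
    case True
    have "v (coeff A k) \<le> (\<Sum>i\<le>degree A. v (coeff A i))"
      using True by (intro member_le_sum) auto
    moreover have "r ^ k \<le> r ^ degree A"
      using True assms by (intro power_increasing)
    ultimately show ?thesis
      using assms by (auto intro!: mult_mono sum_nonneg)
  next
    case False
    then show ?thesis
      using assms by (auto simp: coeff_eq_0 intro!: mult_nonneg_nonneg sum_nonneg)
  qed
qed

text \<open>
  The Gauss norm is multiplicative and that of \<open>B\<close> is bounded below at all radii \<open>r \<ge> 1\<close>, so
  \<open>h\<close> grows at most like the polynomial \<open>B h\<close>.
\<close>

lemma polynomial_if_mult_polynomial:
  assumes h: "entire_series h" and B: "B \<noteq> 0" and T: "fps_of_poly B * h = fps_of_poly T"
  shows "h \<in> range fps_of_poly"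
proof (rule polynomial_if_growth)
  fix r :: real and k
  assume r: "r \<ge> 1"
  let ?C = "(\<Sum>i\<le>degree T. v (coeff T i))"
  have "v (lead_coeff B) * 1 \<le> v (lead_coeff B) * r ^ degree B"
    using r by (intro mult_left_mono) auto
  also have "\<dots> \<le> gauss_norm r (fps_of_poly B)"
    using coeff_le_gauss_norm[of "fps_of_poly B" r "degree B"] r by simp
  finally have B_ge: "v (lead_coeff B) \<le> gauss_norm r (fps_of_poly B)" by simp
  have "v (lead_coeff B) * (v (fps_nth h k) * r ^ k)
      \<le> gauss_norm r (fps_of_poly B) * gauss_norm r h"
    using B_ge h r coeff_le_gauss_norm by (intro mult_mono) (auto intro: gauss_norm_nonneg)
  also have "\<dots> = gauss_norm r (fps_of_poly T)"
    using h r by (simp add: gauss_norm_mult flip: T)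
  also have "\<dots> \<le> ?C * r ^ degree T"
    using r by (rule gauss_norm_poly_le)
  finally show "v (fps_nth h k) * r ^ k \<le> ?C / v (lead_coeff B) * r ^ degree T"
    using B by (simp add: field_simps)
qed

lemma dominant_index_poly:
  assumes "A \<noteq> 0"
  obtains R where "R \<ge> 1" "\<And>r. r \<ge> R \<Longrightarrow> dominant_index r (fps_of_poly A) (degree A)"
proof -
  let ?C = "(\<Sum>i\<le>degree A. v (coeff A i)) / v (lead_coeff A) + 1"
  have lc: "v (lead_coeff A) > 0" using assms by simp
  have dom: "dominant_index r (fps_of_poly A) (degree A)" if r: "r \<ge> ?C" for r
  proof -
    have r1: "r \<ge> 1"
    proof -
      have "(\<Sum>i\<le>degree A. v (coeff A i)) / v (lead_coeff A) \<ge> 0"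
        by (intro divide_nonneg_nonneg sum_nonneg) auto
      then show ?thesis using r by linarith
    qed
    have less: "v (coeff A k) * r ^ k < v (lead_coeff A) * r ^ degree A" if "k \<noteq> degree A" for k
    proof (cases "k < degree A")
      case True
      have "v (coeff A k) \<le> (\<Sum>i\<le>degree A. v (coeff A i))"
        using True by (intro member_le_sum) auto
      also have "\<dots> < v (lead_coeff A) * r"
      proof -
        have "(\<Sum>i\<le>degree A. v (coeff A i)) / v (lead_coeff A) < r"
          using r by linarith
        then show ?thesis
          using lc by (simp only: pos_divide_less_eq mult.commute)
      qed
      finally have "v (coeff A k) * r ^ k < (v (lead_coeff A) * r) * r ^ k"
        using r1 by (intro mult_strict_right_mono) auto
      also have "\<dots> = v (lead_coeff A) * r ^ Suc k" by simp
      also have "\<dots> \<le> v (lead_coeff A) * r ^ degree A"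
        using True r1 by (intro mult_left_mono power_increasing) auto
      finally show ?thesis .
    next
      case False
      then have "coeff A k = 0"
        using that by (intro coeff_eq_0) auto
      then show ?thesis using lc r1 by auto
    qed
    then show ?thesis
      unfolding dominant_index_def using assms
      by (metis fps_of_poly_nth leading_coeff_0_iff less_imp_neq less_eq_real_def)
  qed
  have "?C \<ge> 1"
    by (auto intro!: divide_nonneg_nonneg sum_nonneg)
  then show thesis using dom that by blast
qed

section \<open>Approximate square roots of polynomials\<close>

text \<open>
  Comparing coefficients of index \<open>k\<close> in \<open>S\<^sup>2 = a\<close> determines \<open>2 S\<^sub>k\<close> from \<open>a\<^sub>k\<close> and products of
  earlier coefficients.  When the residue characteristic is \<open>2\<close> each step divides by a number of absolute
  value less than \<open>1\<close>; the factors \<open>v 4\<close> and \<open>v 2\<close> are what makes the induction absorb this loss.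
\<close>

lemma sqrt_coeff_bound:
  assumes S: "S\<^sup>2 = a" "fps_nth S 0 = 1" and \<rho>: "\<rho> > 0"
    and a: "\<And>k. k \<ge> 1 \<Longrightarrow> v (fps_nth a k) \<le> v 4 * \<rho> ^ k" and "k \<ge> 1"
  shows "v (fps_nth S k) \<le> v 2 * \<rho> ^ k"
  using \<open>k \<ge> 1\<close>
proof (induction k rule: less_induct)
  case (less k)
  have v4: "v 4 = v 2 * v 2"
    by (simp flip: v_mult)
  let ?T = "\<Sum>i\<in>{1..<k}. fps_nth S i * fps_nth S (k - i)"
  have "{0..k} = insert 0 (insert k {1..<k})"
    using less.prems by auto
  then have "fps_nth a k = 2 * fps_nth S k + ?T"
    using less.prems S(2) by (simp add: power2_eq_square fps_mult_nth flip: S(1))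
  then have "v (2 * fps_nth S k) \<le> max (v (fps_nth a k)) (v ?T)"
    using v_diff_le_max[of "fps_nth a k" ?T] by simp
  also have "\<dots> \<le> v 4 * \<rho> ^ k"
  proof (rule max.boundedI)
    show "v ?T \<le> v 4 * \<rho> ^ k"
    proof (rule v_sum_le)
      fix i assume i: "i \<in> {1..<k}"
      then have "v (fps_nth S i) * v (fps_nth S (k - i)) \<le> (v 2 * \<rho> ^ i) * (v 2 * \<rho> ^ (k - i))"
        using \<rho> by (intro mult_mono less.IH) auto
      also have "\<dots> = v 4 * \<rho> ^ (i + (k - i))"
        by (simp add: v4 power_add)
      finally show "v (fps_nth S i * fps_nth S (k - i)) \<le> v 4 * \<rho> ^ k"
        using i by (simp add: v_mult)
    qed (use \<rho> in simp)
  qed (use a less.prems in simp)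
  finally have "v 2 * v (fps_nth S k) \<le> v 2 * (v 2 * \<rho> ^ k)"
    by (simp add: v_mult v4 mult.assoc)
  then show ?case
    by (subst (asm) mult_le_cancel_left_pos) auto
qed

text \<open>
  At infinity a monic \<open>D\<close> of degree \<open>2 d\<close> has the square root \<open>x\<^sup>d S(1/x)\<close>, where \<open>S\<close> is the formal
  square root of the reflected polynomial.  Cutting \<open>S\<close> off after the index \<open>N + d\<close> and clearing
  denominators gives a polynomial \<open>q\<close> whose square agrees with \<open>x\<^sup>2\<^sup>N D\<close> in the upper half of the
  coefficients; the lower half has the size that the radius of convergence \<open>1/\<rho>\<close> of \<open>S\<close> predicts.
\<close>

lemma truncated_sqrt_of_monic:
  assumes D: "lead_coeff D = 1" "degree D = 2 * d"
  obtains \<rho> where "\<rho> > 0"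
    and "\<And>i. v (coeff D i) \<le> (if i \<le> 2 * d then \<rho> ^ (2 * d - i) else 0)"
    and "\<And>N. \<exists>q. (\<forall>j. v (fps_nth q j) \<le> (if j \<le> N + d then \<rho> ^ (N + d - j) else 0)) \<and>
      (\<forall>j. v (fps_nth (q\<^sup>2 - fps_X ^ (2 * N) * fps_of_poly D) j)
         \<le> (if j < N + d then \<rho> ^ (2 * (N + d) - j) else 0))"
proof -
  define a where "a = fps_of_poly (reflect_poly D)"
  define S where "S = fps_radical (\<lambda>_ _. 1) 2 a"
  have a_nth: "fps_nth a k = (if k > 2 * d then 0 else coeff D (2 * d - k))" for k
    by (simp add: a_def coeff_reflect_poly D(2))
  have a0: "fps_nth a 0 = 1"
    using D by (simp add: a_nth)
  have S2: "S\<^sup>2 = a"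
    using power_radical[of a "\<lambda>_ _. 1" 1] a0 by (simp add: S_def numeral_2_eq_2)
  have S0: "fps_nth S 0 = 1"
    by (simp add: S_def)
  \<comment> \<open>The summand \<open>1\<close> ensures \<open>\<rho> \<ge> 1\<close>, so that \<open>\<rho> \<le> \<rho>\<^sup>k\<close> and one bound serves all coefficients.\<close>
  define \<rho> where "\<rho> = (\<Sum>i\<le>2 * d. v (coeff D i)) / v 4 + 1"
  have \<rho>1: "\<rho> \<ge> 1"
    by (auto simp: \<rho>_def intro!: divide_nonneg_nonneg sum_nonneg)
  have a_le: "v (fps_nth a k) \<le> v 4 * \<rho> ^ k" if "k \<ge> 1" for k
  proof -
    have "v (fps_nth a k) \<le> (\<Sum>i\<le>2 * d. v (coeff D i))"
      by (auto simp: a_nth intro!: sum_nonneg member_le_sum)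
    also have "\<dots> \<le> v 4 * \<rho>"
      by (simp add: \<rho>_def distrib_left)
    also have "\<dots> \<le> v 4 * \<rho> ^ k"
      using \<rho>1 that by (intro mult_left_mono self_le_power) auto
    finally show ?thesis .
  qed
  have v2: "v 2 \<le> 1" "v 4 \<le> 1"
    using v_of_nat_le_1[of 2] v_of_nat_le_1[of 4] by simp_all
  have S_le: "v (fps_nth S k) \<le> \<rho> ^ k" for k
  proof (cases "k = 0")
    case False
    then have "v (fps_nth S k) \<le> v 2 * \<rho> ^ k"
      using \<rho>1 by (intro sqrt_coeff_bound[OF S2 S0 _ a_le]) auto
    also have "\<dots> \<le> 1 * \<rho> ^ k"
      using v2 \<rho>1 by (intro mult_right_mono) auto
    finally show ?thesis by simp
  qed (simp add: S0)
  have D_le: "v (coeff D i) \<le> \<rho> ^ (2 * d - i)" if "i \<le> 2 * d" for i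
  proof (cases "i = 2 * d")
    case False
    then have "v (fps_nth a (2 * d - i)) \<le> v 4 * \<rho> ^ (2 * d - i)"
      using that by (intro a_le) auto
    also have "\<dots> \<le> 1 * \<rho> ^ (2 * d - i)"
      using v2 \<rho>1 by (intro mult_right_mono) auto
    also have "fps_nth a (2 * d - i) = coeff D i"
      using that by (auto simp: a_nth)
    finally show ?thesis by simp
  qed (use D in simp)
  show thesis
  proof
    show "\<rho> > 0" using \<rho>1 by simp
    show "v (coeff D i) \<le> (if i \<le> 2 * d then \<rho> ^ (2 * d - i) else 0)" for i
      using D_le D by (auto simp: coeff_eq_0)
    fix N
    define e where "e = N + d"
    define q where "q = Abs_fps (\<lambda>j. if j \<le> e then fps_nth S (e - j) else 0)"
    have q_nth: "fps_nth q j = (if j \<le> e then fps_nth S (e - j) else 0)" for j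
      by (simp add: q_def)
    have XD: "fps_nth (fps_X ^ (2 * N) * fps_of_poly D) j = (if j < 2 * N then 0 else coeff D (j - 2 * N))" for j
      by (simp add: fps_X_power_mult_nth)
    have high: "fps_nth (q\<^sup>2 - fps_X ^ (2 * N) * fps_of_poly D) j = 0" if j: "j \<ge> e" for j
    proof (cases "j \<le> 2 * e")
      case True
      have "fps_nth (q\<^sup>2) j = (\<Sum>i=0..j. fps_nth q i * fps_nth q (j - i))"
        by (simp add: power2_eq_square fps_mult_nth)
      also have "\<dots> = (\<Sum>i=j-e..e. fps_nth S (e - i) * fps_nth S (e - (j - i)))"
        using j by (intro sum.mono_neutral_cong_right) (auto simp: q_nth)
      also have "\<dots> = (\<Sum>b=0..2*e-j. fps_nth S b * fps_nth S (2 * e - j - b))"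
      proof (rule sum.reindex_bij_witness[of _ "\<lambda>b. e - b" "\<lambda>i. e - i"])
        fix i assume i: "i \<in> {j-e..e}"
        then have "2 * e - j - (e - i) = e - (j - i)"
          using j True by auto
        then show "fps_nth S (e - i) * fps_nth S (2 * e - j - (e - i))
            = fps_nth S (e - i) * fps_nth S (e - (j - i))" by simp
      qed (use j True in auto)
      also have "\<dots> = fps_nth a (2 * e - j)"
        by (simp add: power2_eq_square fps_mult_nth flip: S2)
      also have "\<dots> = (if j < 2 * N then 0 else coeff D (j - 2 * N))"
        using True by (auto simp: a_nth e_def intro!: arg_cong[of _ _ "coeff D"])
      finally show ?thesis by (simp add: XD)
    next
      case False
      have "fps_nth (q\<^sup>2) j = 0"
        unfolding power2_eq_square fps_mult_nth
        using False by (intro sum.neutral) (auto simp: q_nth)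
      moreover have "coeff D (j - 2 * N) = 0"
        using False D by (intro coeff_eq_0) (auto simp: e_def)
      ultimately show ?thesis by (simp add: XD)
    qed
    have low: "v (fps_nth (q\<^sup>2 - fps_X ^ (2 * N) * fps_of_poly D) j) \<le> \<rho> ^ (2 * e - j)"
      if j: "j < e" for j
    proof -
      have "v (fps_nth (q\<^sup>2) j) \<le> \<rho> ^ (2 * e - j)"
        unfolding power2_eq_square fps_mult_nth
      proof (rule v_sum_le)
        fix i assume i: "i \<in> {0..j}"
        have "v (fps_nth q i) * v (fps_nth q (j - i)) \<le> \<rho> ^ (e - i) * \<rho> ^ (e - (j - i))"
          using i j S_le \<rho>1 by (intro mult_mono) (auto simp: q_nth)
        also have "\<dots> = \<rho> ^ (2 * e - j)"
          using i j by (simp add: mult_2 flip: power_add)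
        finally show "v (fps_nth q i * fps_nth q (j - i)) \<le> \<rho> ^ (2 * e - j)"
          by (simp add: v_mult)
      qed (use \<rho>1 in simp)
      moreover have "v (fps_nth (fps_X ^ (2 * N) * fps_of_poly D) j) \<le> \<rho> ^ (2 * e - j)"
      proof (cases "j < 2 * N")
        case False
        then have "v (coeff D (j - 2 * N)) \<le> \<rho> ^ (2 * d - (j - 2 * N))"
          using j by (intro D_le) (auto simp: e_def)
        moreover have "2 * d - (j - 2 * N) = 2 * e - j"
          using False by (simp add: e_def)
        ultimately show ?thesis using False by (simp add: XD)
      qed (use \<rho>1 in \<open>simp add: XD\<close>)
      ultimately show ?thesis
        unfolding fps_sub_nth using v_diff_le_max order_trans max.boundedI by metis
    qed
    have "v (fps_nth q j) \<le> (if j \<le> N + d then \<rho> ^ (N + d - j) else 0)" for j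
      using S_le by (simp add: q_nth e_def)
    moreover have "v (fps_nth (q\<^sup>2 - fps_X ^ (2 * N) * fps_of_poly D) j)
        \<le> (if j < N + d then \<rho> ^ (2 * (N + d) - j) else 0)" for j
      using low[of j] high[of j] by (simp add: e_def not_less)
    ultimately show "\<exists>q. (\<forall>j. v (fps_nth q j) \<le> (if j \<le> N + d then \<rho> ^ (N + d - j) else 0)) \<and>
      (\<forall>j. v (fps_nth (q\<^sup>2 - fps_X ^ (2 * N) * fps_of_poly D) j)
         \<le> (if j < N + d then \<rho> ^ (2 * (N + d) - j) else 0))" by blast
  qed
qed

text \<open>
  For radii at least \<open>R\<close> the error of the truncated square root, relative to the Gauss norm of
  \<open>x\<^sup>2\<^sup>N D\<close>, is at most a power of \<open>1/2\<close> that tends to \<open>0\<close> with growing \<open>N\<close>, uniformly in the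
  radius.  The leading coefficient is only approximated by a square as well, with an error below \<open>\<epsilon>\<close>.
  The bound on \<open>Q\<close> is \<open>r\<^sup>N\<close> times a quantity independent of \<open>\<epsilon>\<close>, which is what keeps the
  final growth estimate independent of the quality of the approximation.
\<close>

lemma approximate_sqrt:
  assumes D: "D \<noteq> 0" "degree D = 2 * d"
    and squares: "\<And>\<epsilon>. \<epsilon> > 0 \<Longrightarrow> \<exists>l. v (l\<^sup>2 - lead_coeff D) < \<epsilon>"
  obtains R where "R > 0"
    and "\<And>\<epsilon>. \<epsilon> > 0 \<Longrightarrow> \<exists>N Q. entire_series Q \<and>
      (\<forall>r\<ge>R. \<forall>k. v (fps_nth Q k) * r ^ k \<le> sqrt (v (lead_coeff D)) * r ^ (N + d)) \<and>
      (\<forall>r\<ge>R. \<forall>k. v (fps_nth (Q\<^sup>2 - fps_X ^ (2 * N) * fps_of_poly D) k) * r ^ k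
         \<le> \<epsilon> * r ^ (2 * (N + d)))"
proof -
  define \<delta> where "\<delta> = lead_coeff D"
  have \<delta>: "\<delta> \<noteq> 0" using D(1) by (simp add: \<delta>_def)
  define D1 where "D1 = smult (inverse \<delta>) D"
  have D1: "lead_coeff D1 = 1" "degree D1 = 2 * d"
    using D \<delta> by (simp_all add: D1_def) (simp add: \<delta>_def)
  have D_D1: "fps_of_poly D = fps_const \<delta> * fps_of_poly D1"
    using \<delta> by (simp add: D1_def fps_of_poly_smult flip: mult.assoc fps_const_mult)
  obtain \<rho> where \<rho>: "\<rho> > 0"
    and D1_le: "\<And>i. v (coeff D1 i) \<le> (if i \<le> 2 * d then \<rho> ^ (2 * d - i) else 0)"
    and approx: "\<And>N. \<exists>q. (\<forall>j. v (fps_nth q j) \<le> (if j \<le> N + d then \<rho> ^ (N + d - j) else 0)) \<and>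
      (\<forall>j. v (fps_nth (q\<^sup>2 - fps_X ^ (2 * N) * fps_of_poly D1) j)
         \<le> (if j < N + d then \<rho> ^ (2 * (N + d) - j) else 0))"
    using truncated_sqrt_of_monic[OF D1] by blast
  show thesis
  proof
    show "2 * \<rho> > 0" using \<rho> by simp
    fix \<epsilon> :: real assume \<epsilon>: "\<epsilon> > 0"
    \<comment> \<open>The minimum with \<open>v \<delta>\<close> forces \<open>v (l\<^sup>2) = v \<delta>\<close>, whatever \<open>\<epsilon>\<close> is.\<close>
    obtain l where l: "v (l\<^sup>2 - \<delta>) < min \<epsilon> (v \<delta>)"
      using squares[of "min \<epsilon> (v \<delta>)"] \<epsilon> \<delta> by (auto simp: \<delta>_def)
    have l2: "v l ^ 2 = v \<delta>"
      using v_add_eq_left[of "l\<^sup>2 - \<delta>" \<delta>] l by (simp add: v_power)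
    then have vl: "v l = sqrt (v \<delta>)"
      by (metis real_sqrt_abs abs_of_nonneg v_nonneg)
    obtain N where N: "(1/2) ^ N < \<epsilon> / v \<delta>"
      using real_arch_pow_inv[of "\<epsilon> / v \<delta>" "1/2"] \<epsilon> \<delta> by auto
    define e where "e = N + d"
    obtain q where q: "\<And>j. v (fps_nth q j) \<le> (if j \<le> e then \<rho> ^ (e - j) else 0)"
      and E: "\<And>j. v (fps_nth (q\<^sup>2 - fps_X ^ (2 * N) * fps_of_poly D1) j)
         \<le> (if j < e then \<rho> ^ (2 * e - j) else 0)"
      using approx[of N] unfolding e_def by blast
    define Q where "Q = fps_const l * q"
    have pw: "\<rho> ^ (n - j) * r ^ j \<le> r ^ n" if "r \<ge> 2 * \<rho>" "j \<le> n" for r j n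
    proof -
      have "\<rho> ^ (n - j) * r ^ j \<le> r ^ (n - j) * r ^ j"
        using that \<rho> by (intro mult_right_mono power_mono) auto
      then show ?thesis
        using that by (simp flip: power_add)
    qed
    have q_le: "v (fps_nth q j) * r ^ j \<le> r ^ e" if r: "r \<ge> 2 * \<rho>" for r j
    proof (cases "j \<le> e")
      case True
      have "v (fps_nth q j) * r ^ j \<le> \<rho> ^ (e - j) * r ^ j"
        using q[of j] True r \<rho> by (intro mult_right_mono) auto
      then show ?thesis using pw[OF r True] by linarith
    next
      case False
      then have "fps_nth q j = 0" using q[of j] v_nonneg[of "fps_nth q j"] by (simp add: antisym)
      then show ?thesis using r \<rho> by simp
    qed
    have Q_le: "v (fps_nth Q j) * r ^ j \<le> sqrt (v \<delta>) * r ^ e" if r: "r \<ge> 2 * \<rho>" for r j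
      using q_le[OF r, of j] by (simp add: Q_def v_mult vl mult.assoc mult_left_mono)
    have "fps_nth Q j = 0" if "j \<ge> Suc e" for j
      using q[of j] that v_nonneg[of "fps_nth q j"] by (simp add: Q_def antisym)
    then have "Q = fps_of_poly (truncate_fps (Suc e) Q)"
      by (intro fps_ext) (auto simp: fps_of_poly_truncate)
    then have "entire_series Q"
      by (metis entire_series_poly)
    have E_le: "v (fps_nth (Q\<^sup>2 - fps_X ^ (2 * N) * fps_of_poly D) j) * r ^ j \<le> \<epsilon> * r ^ (2 * e)"
      if r: "r \<ge> 2 * \<rho>" for r j
    proof -
      let ?E = "q\<^sup>2 - fps_X ^ (2 * N) * fps_of_poly D1"
      let ?F = "fps_X ^ (2 * N) * fps_of_poly D1"
      have "(b * q)\<^sup>2 - X * (c * F) = b\<^sup>2 * (q\<^sup>2 - X * F) + (b\<^sup>2 - c) * (X * F)" for b c X F :: "'a fps"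
        by (simp add: algebra_simps power_mult_distrib)
      then have "Q\<^sup>2 - fps_X ^ (2 * N) * fps_of_poly D = fps_const (l\<^sup>2) * ?E + fps_const (l\<^sup>2 - \<delta>) * ?F"
        unfolding Q_def D_D1 fps_const_sub[symmetric] fps_const_power[symmetric] by blast
      then have nth: "fps_nth (Q\<^sup>2 - fps_X ^ (2 * N) * fps_of_poly D) j
          = l\<^sup>2 * fps_nth ?E j + (l\<^sup>2 - \<delta>) * fps_nth ?F j"
        by (simp del: fps_sub_nth)
      have "v (l\<^sup>2 * fps_nth ?E j) * r ^ j \<le> \<epsilon> * r ^ (2 * e)"
      proof (cases "j < e")
        case True
        have "v (fps_nth ?E j) * r ^ j \<le> \<rho> ^ (2 * e - j) * r ^ j"
          using E[of j] True r \<rho> by (intro mult_right_mono) auto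
        also have "\<dots> \<le> (r / 2) ^ (2 * e - j) * r ^ j"
          using r \<rho> by (intro mult_right_mono power_mono) auto
        also have "\<dots> = (1 / 2) ^ (2 * e - j) * r ^ (2 * e)"
          using True by (simp add: power_divide flip: power_add)
        also have "\<dots> \<le> (1 / 2) ^ N * r ^ (2 * e)"
          using True r \<rho> by (intro mult_right_mono power_decreasing) (auto simp: e_def)
        also have "\<dots> \<le> \<epsilon> / v \<delta> * r ^ (2 * e)"
          using N r \<rho> by (intro mult_right_mono) auto
        finally have "v \<delta> * (v (fps_nth ?E j) * r ^ j) \<le> v \<delta> * (\<epsilon> / v \<delta> * r ^ (2 * e))"
          by (intro mult_left_mono) auto
        then show ?thesis
          using \<delta> by (simp add: v_mult v_power l2 mult.assoc del: fps_sub_nth)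
      next
        case False
        then have "fps_nth ?E j = 0"
          using E[of j] v_nonneg[of "fps_nth ?E j"] by (simp add: antisym del: fps_sub_nth)
        then show ?thesis using \<epsilon> r \<rho> by (simp del: fps_sub_nth)
      qed
      moreover have "v ((l\<^sup>2 - \<delta>) * fps_nth ?F j) * r ^ j \<le> \<epsilon> * r ^ (2 * e)"
      proof (cases "2 * N \<le> j \<and> j - 2 * N \<le> 2 * d")
        case True
        have "v (coeff D1 (j - 2 * N)) * r ^ j \<le> \<rho> ^ (2 * d - (j - 2 * N)) * r ^ j"
          using D1_le[of "j - 2 * N"] True r \<rho> by (intro mult_right_mono) auto
        also have "2 * d - (j - 2 * N) = 2 * e - j"
          using True by (simp add: e_def)
        also have "\<rho> ^ (2 * e - j) * r ^ j \<le> r ^ (2 * e)"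
          using True r by (intro pw) (auto simp: e_def)
        finally have "v (l\<^sup>2 - \<delta>) * (v (coeff D1 (j - 2 * N)) * r ^ j) \<le> \<epsilon> * r ^ (2 * e)"
          using l r \<rho> \<epsilon> by (intro mult_mono) auto
        then show ?thesis
          using True by (simp add: v_mult fps_X_power_mult_nth mult.assoc)
      next
        case False
        then have "fps_nth ?F j = 0"
          using D1(2) by (auto simp: fps_X_power_mult_nth coeff_eq_0)
        then show ?thesis using \<epsilon> r \<rho> by simp
      qed
      ultimately have "max (v (l\<^sup>2 * fps_nth ?E j)) (v ((l\<^sup>2 - \<delta>) * fps_nth ?F j)) * r ^ j \<le> \<epsilon> * r ^ (2 * e)"
        by (simp add: max_def del: fps_sub_nth)
      moreover have "v (l\<^sup>2 * fps_nth ?E j + (l\<^sup>2 - \<delta>) * fps_nth ?F j) * r ^ j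
          \<le> max (v (l\<^sup>2 * fps_nth ?E j)) (v ((l\<^sup>2 - \<delta>) * fps_nth ?F j)) * r ^ j"
        using r \<rho> by (intro mult_right_mono v_add_le_max) auto
      ultimately show ?thesis
        unfolding nth by linarith
    qed
    show "\<exists>N Q. entire_series Q \<and>
      (\<forall>r\<ge>2 * \<rho>. \<forall>k. v (fps_nth Q k) * r ^ k \<le> sqrt (v (lead_coeff D)) * r ^ (N + d)) \<and>
      (\<forall>r\<ge>2 * \<rho>. \<forall>k. v (fps_nth (Q\<^sup>2 - fps_X ^ (2 * N) * fps_of_poly D) k) * r ^ k
         \<le> \<epsilon> * r ^ (2 * (N + d)))"
      using \<open>entire_series Q\<close> Q_le E_le unfolding \<delta>_def e_def by blast
  qed
qed

section \<open>The Pell equation over entire series\<close>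

text \<open>
  If \<open>P\<^sup>2\<close> had a larger Gauss norm than \<open>A\<close> at some large radius, then \<open>P\<^sup>2\<close> and \<open>D g\<^sup>2\<close> would have the
  same dominant index there; but these indices have different parities.  So \<open>P\<close> grows at most
  like a square root of \<open>A\<close>.
\<close>

lemma pell_polynomial_odd:
  assumes P: "entire_series P" and g: "entire_series g" and D: "odd (degree D)"
    and pell: "P\<^sup>2 - fps_of_poly D * g\<^sup>2 = fps_of_poly A"
  shows "P \<in> range fps_of_poly"
proof -
  have "D \<noteq> 0" using D by auto
  then obtain R where R: "R \<ge> 1" "\<And>r. r \<ge> R \<Longrightarrow> dominant_index r (fps_of_poly D) (degree D)"
    using dominant_index_poly by blast
  let ?C = "\<Sum>i\<le>degree A. v (coeff A i)"
  have small: "(gauss_norm r P)\<^sup>2 \<le> gauss_norm r (fps_of_poly A)" if r: "r \<ge> R" for r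
  proof (rule ccontr)
    assume contr: "\<not> ?thesis"
    have r0: "r > 0" using r R by simp
    have "gauss_norm r (fps_of_poly A) \<ge> 0"
      using r0 by (intro gauss_norm_nonneg) auto
    then have "P \<noteq> 0" using contr by auto
    then obtain n where n: "dominant_index r P n"
      using dominant_index_exists[OF P] r0 by blast
    have nn: "dominant_index r (P\<^sup>2) (n + n)"
      unfolding power2_eq_square by (intro dominant_index_mult n r0)
    have "v (fps_nth (- fps_of_poly A) k) * r ^ k < v (fps_nth (P\<^sup>2) (n + n)) * r ^ (n + n)" for k
    proof -
      have "v (fps_nth (- fps_of_poly A) k) * r ^ k \<le> gauss_norm r (fps_of_poly A)"
        using coeff_le_gauss_norm[of "fps_of_poly A" r k] r0 by simp
      also have "\<dots> < (gauss_norm r P)\<^sup>2" using contr by simp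
      also have "\<dots> = gauss_norm r (P\<^sup>2)"
        using P r0 by (simp add: gauss_norm_mult power2_eq_square)
      finally show ?thesis
        using gauss_norm_eq_dominant[OF nn] by simp
    qed
    then have dom: "dominant_index r (P\<^sup>2 + - fps_of_poly A) (n + n)"
      by (intro dominant_index_add nn r0)
    moreover have eq: "P\<^sup>2 + - fps_of_poly A = fps_of_poly D * (g * g)"
      using pell by (simp add: algebra_simps power2_eq_square)
    ultimately have "g \<noteq> 0"
      by (auto simp: dominant_index_def)
    then obtain m where m: "dominant_index r g m"
      using dominant_index_exists[OF g] r0 by blast
    have "dominant_index r (fps_of_poly D * (g * g)) (degree D + (m + m))"
      by (intro dominant_index_mult m r0 R(2) r)
    then have "n + n = degree D + (m + m)"
      using dom unfolding eq by (intro dominant_index_unique)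
    then show False
      using D by presburger
  qed
  show ?thesis
  proof (rule polynomial_if_growth)
    fix r :: real and k
    assume r: "r \<ge> R"
    have "v (fps_nth P k) * r ^ k \<le> gauss_norm r P"
      using P r R by (intro coeff_le_gauss_norm) auto
    also have "\<dots> \<le> 1 + (gauss_norm r P)\<^sup>2"
    proof -
      have "0 \<le> (gauss_norm r P - 1)\<^sup>2" "0 \<le> (gauss_norm r P)\<^sup>2" by simp_all
      then show ?thesis unfolding power2_diff one_power2 by linarith
    qed
    also have "\<dots> \<le> 1 * r ^ degree A + ?C * r ^ degree A"
      using small[OF r] gauss_norm_poly_le[of r A] r R by (intro add_mono) auto
    finally show "v (fps_nth P k) * r ^ k \<le> (1 + ?C) * r ^ degree A"
      by (simp add: distrib_right)
  qed
qed

text \<open>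
  The term of index \<open>n\<close> of \<open>U\<close> grows by the factor \<open>2\<^sup>n\<close> between the radii \<open>r\<close> and \<open>2 r\<close>.  It is
  bounded above at \<open>2 r\<close>, and bounded below at \<open>r\<close> because \<open>V\<close> is bounded above and the norm
  of \<open>U V\<close> is known; this bounds \<open>n\<close>.
\<close>

lemma dominant_index_growth_bound:
  assumes n: "dominant_index r U n" and m: "dominant_index r V m"
    and U: "v (fps_nth U n) * (2 * r) ^ n \<le> (2 * r) ^ N * x"
    and V: "v (fps_nth V m) * r ^ m \<le> r ^ N * y"
    and prod: "v (fps_nth U n) * v (fps_nth V m) = c" and nm: "n + m = 2 * N + a"
    and K: "x * y \<le> 2 ^ K * (c * r ^ a)" and r: "r > 0"
  shows "n \<le> N + K"
proof -
  have "2 ^ n * (c * r ^ a) * r ^ (2 * N) = (v (fps_nth U n) * (2 * r) ^ n) * (v (fps_nth V m) * r ^ m)"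
  proof -
    have "r ^ n * r ^ m = r ^ (2 * N) * r ^ a"
      by (simp add: nm flip: power_add)
    then show ?thesis
      by (simp add: power_mult_distrib ac_simps flip: prod)
  qed
  also have "\<dots> \<le> ((2 * r) ^ N * x) * (r ^ N * y)"
    by (rule mult_mono'[OF U V]) (use r in auto)
  also have "\<dots> = 2 ^ N * (x * y) * r ^ (2 * N)"
    unfolding power_even_eq power2_eq_square power_mult_distrib by (simp add: ac_simps)
  also have "\<dots> \<le> 2 ^ N * (2 ^ K * (c * r ^ a)) * r ^ (2 * N)"
    using K r by (intro mult_right_mono mult_left_mono) auto
  also have "\<dots> = 2 ^ (N + K) * (c * r ^ a) * r ^ (2 * N)"
    by (simp add: power_add mult.assoc)
  finally have "2 ^ n * (c * r ^ a) \<le> 2 ^ (N + K) * (c * r ^ a)"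
    using r by (subst (asm) mult_le_cancel_right_pos) auto
  moreover have "c > 0"
    using n m by (auto simp: dominant_index_def simp flip: prod v_mult)
  ultimately have "(2::real) ^ n \<le> 2 ^ (N + K)"
    using r by simp
  then show ?thesis
    by (subst (asm) power_increasing_iff) auto
qed

text \<open>
  With an exact square root \<open>Q\<close> of \<open>D\<close> the factors of \<open>(P + Q g) (P - Q g) = A\<close> would have
  dominant indices that add up to the constant \<open>degree A\<close>; as neither decreases with growing radius, both are
  constant, so both factors, and then \<open>P\<close>, grow like a power of the radius.  An approximate root, scaled by
  \<open>x\<^sup>N\<close>, serves equally well at the finitely many radii that one estimate of \<open>P\<close> involves:
  \<open>r1\<close> and \<open>2 r1\<close>, which are fixed and bound the exponent, and the arbitrary radius \<open>r2\<close>.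
\<close>

lemma pell_polynomial_even:
  assumes P: "entire_series P" and g: "entire_series g"
    and D: "D \<noteq> 0" "degree D = 2 * d" and A: "A \<noteq> 0"
    and pell: "P\<^sup>2 - fps_of_poly D * g\<^sup>2 = fps_of_poly A"
    and squares: "\<And>\<epsilon>. \<epsilon> > 0 \<Longrightarrow> \<exists>l. v (l\<^sup>2 - lead_coeff D) < \<epsilon>"
  shows "P \<in> range fps_of_poly"
proof -
  obtain RA where RA: "RA \<ge> 1" "\<And>r. r \<ge> RA \<Longrightarrow> dominant_index r (fps_of_poly A) (degree A)"
    using dominant_index_poly[OF A] by blast
  obtain R where "R > 0"
    and approx: "\<And>\<epsilon>. \<epsilon> > 0 \<Longrightarrow> \<exists>N Q. entire_series Q \<and>
      (\<forall>r\<ge>R. \<forall>k. v (fps_nth Q k) * r ^ k \<le> sqrt (v (lead_coeff D)) * r ^ (N + d)) \<and>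
      (\<forall>r\<ge>R. \<forall>k. v (fps_nth (Q\<^sup>2 - fps_X ^ (2 * N) * fps_of_poly D) k) * r ^ k
         \<le> \<epsilon> * r ^ (2 * (N + d)))"
    using approximate_sqrt[OF D squares] by blast
  define a where "a = degree A"
  define c where "c = v (lead_coeff A)"
  have c: "c > 0" using A by (simp add: c_def)
  define r1 where "r1 = max RA R"
  have r1: "r1 > 0" "r1 \<ge> RA" "r1 \<ge> R"
    using RA(1) by (auto simp: r1_def)
  \<comment> \<open>An upper bound for the Gauss norms of \<open>P \<plusminus> Q g\<close>, without the factor \<open>r\<^sup>N\<close> caused by
    the scaling; it does not depend on \<open>N\<close>.\<close>
  define \<mu> where "\<mu> r = max (gauss_norm r P) (sqrt (v (lead_coeff D)) * r ^ d * gauss_norm r g)" for r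
  obtain K where "\<mu> (2 * r1) * \<mu> r1 / (c * r1 ^ a) < 2 ^ K"
    using real_arch_pow[of 2 "\<mu> (2 * r1) * \<mu> r1 / (c * r1 ^ a)"] by auto
  then have K: "\<mu> (2 * r1) * \<mu> r1 \<le> 2 ^ K * (c * r1 ^ a)"
    using c r1 by (simp add: pos_divide_less_eq less_imp_le)
  show ?thesis
  proof (rule polynomial_if_growth)
    fix r2 :: real and k
    assume r2: "r2 \<ge> 2 * r1"
    define T where "T = {r1, 2 * r1, r2}"
    have T: "r \<ge> RA" "r \<ge> R" "r > 0" if "r \<in> T" for r
      using that r1 r2 by (auto simp: T_def)
    \<comment> \<open>The error term \<open>E g\<^sup>2\<close> has to stay below the dominant term of \<open>A\<close> at the three radii; adding \<open>1\<close>
      keeps the denominators positive, also when \<open>g = 0\<close>.\<close>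
    define \<epsilon> where "\<epsilon> = Min ((\<lambda>r. c * r ^ a / (r ^ (2 * d) * (gauss_norm r g)\<^sup>2 + 1)) ` T)"
    have den: "r ^ (2 * d) * (gauss_norm r g)\<^sup>2 + 1 > 0" if "r \<in> T" for r
      using T(3)[OF that] by (intro add_nonneg_pos) auto
    have \<epsilon>: "\<epsilon> > 0"
    proof -
      have "finite T" "T \<noteq> {}" by (simp_all add: T_def)
      then show ?thesis
        unfolding \<epsilon>_def using c den T(3) by (subst Min_gr_iff) (auto intro!: divide_pos_pos)
    qed
    have \<epsilon>_less: "\<epsilon> * (r ^ (2 * d) * (gauss_norm r g)\<^sup>2) < c * r ^ a" if "r \<in> T" for r
    proof -
      have "\<epsilon> \<le> c * r ^ a / (r ^ (2 * d) * (gauss_norm r g)\<^sup>2 + 1)"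
        unfolding \<epsilon>_def using that by (intro Min_le) (auto simp: T_def)
      then have "\<epsilon> * (r ^ (2 * d) * (gauss_norm r g)\<^sup>2 + 1) \<le> c * r ^ a"
        using den[OF that] by (simp only: pos_le_divide_eq)
      then show ?thesis using \<epsilon> unfolding distrib_left by linarith
    qed
    obtain N Q where Q: "entire_series Q"
      and Q_le: "\<And>r k. r \<ge> R \<Longrightarrow> v (fps_nth Q k) * r ^ k \<le> sqrt (v (lead_coeff D)) * r ^ (N + d)"
      and E_le: "\<And>r k. r \<ge> R \<Longrightarrow> v (fps_nth (Q\<^sup>2 - fps_X ^ (2 * N) * fps_of_poly D) k) * r ^ k
         \<le> \<epsilon> * r ^ (2 * (N + d))"
      using approx[OF \<epsilon>] by blast
    define E where "E = Q\<^sup>2 - fps_X ^ (2 * N) * fps_of_poly D"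
    define U where "U = fps_X ^ N * P + Q * g"
    define V where "V = fps_X ^ N * P - Q * g"
    have X: "entire_series (fps_X ^ N)"
      using entire_series_poly[of "monom 1 N"] by (simp add: fps_of_poly_monom')
    have UV_entire: "entire_series U" "entire_series V"
      unfolding U_def V_def
      by (intro entire_series_add entire_series_diff entire_series_mult X P Q g)+
    have "(X * P + Q * g) * (X * P - Q * g) = X\<^sup>2 * (P\<^sup>2 - F * g\<^sup>2) - (Q\<^sup>2 - X\<^sup>2 * F) * g\<^sup>2"
      for X F :: "'a fps"
      by (simp add: algebra_simps power2_eq_square)
    then have "U * V = fps_X ^ (2 * N) * (P\<^sup>2 - fps_of_poly D * g\<^sup>2) - E * g\<^sup>2"
      unfolding U_def V_def E_def power_even_eq by blast
    then have UV: "U * V = fps_X ^ (2 * N) * fps_of_poly A + - (E * g\<^sup>2)"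
      by (simp add: pell)
    have gX: "gauss_norm r (fps_X ^ N) = r ^ N" if "r > 0" for r
      using gauss_norm_eq_dominant[OF dominant_index_fps_X_power[OF that]] by (simp add: fps_X_power_nth)
    have bound: "max (gauss_norm r U) (gauss_norm r V) \<le> r ^ N * \<mu> r" if "r \<in> T" for r
    proof -
      note r = T[OF that]
      have "gauss_norm r Q \<le> sqrt (v (lead_coeff D)) * r ^ (N + d)"
        using Q_le r by (intro gauss_norm_le) auto
      then have "gauss_norm r Q * gauss_norm r g \<le> sqrt (v (lead_coeff D)) * r ^ (N + d) * gauss_norm r g"
        using g r by (intro mult_right_mono gauss_norm_nonneg) auto
      also have "\<dots> = r ^ N * (sqrt (v (lead_coeff D)) * r ^ d * gauss_norm r g)"
        by (simp add: power_add ac_simps)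
      also have "\<dots> \<le> r ^ N * \<mu> r"
        using r by (intro mult_left_mono) (auto simp: \<mu>_def)
      finally have "gauss_norm r (Q * g) \<le> r ^ N * \<mu> r"
        using r Q g by (simp add: gauss_norm_mult)
      moreover have "gauss_norm r (fps_X ^ N * P) \<le> r ^ N * \<mu> r"
        using r X P by (simp add: gauss_norm_mult gX \<mu>_def)
      ultimately have "max (gauss_norm r (fps_X ^ N * P)) (gauss_norm r (Q * g)) \<le> r ^ N * \<mu> r"
        by simp
      moreover have "gauss_norm r U \<le> max (gauss_norm r (fps_X ^ N * P)) (gauss_norm r (Q * g))"
        unfolding U_def using r by (intro gauss_norm_add_le entire_series_mult X P Q g) auto
      moreover have "gauss_norm r V \<le> max (gauss_norm r (fps_X ^ N * P)) (gauss_norm r (- (Q * g)))"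
        unfolding V_def diff_conv_add_uminus using r
        by (intro gauss_norm_add_le entire_series_minus entire_series_mult X P Q g) auto
      ultimately show ?thesis
        unfolding gauss_norm_minus by linarith
    qed
    have coeff_bound: "v (fps_nth U i) * r ^ i \<le> r ^ N * \<mu> r" "v (fps_nth V i) * r ^ i \<le> r ^ N * \<mu> r"
      if "r \<in> T" for r i
      using bound[OF that] coeff_le_gauss_norm[OF UV_entire(1) T(3)[OF that], of i]
        coeff_le_gauss_norm[OF UV_entire(2) T(3)[OF that], of i] by linarith+
    have dom: "\<exists>n m. dominant_index r U n \<and> dominant_index r V m \<and> n + m = 2 * N + a \<and>
        v (fps_nth U n) * v (fps_nth V m) = c" if "r \<in> T" for r
    proof -
      note r = T[OF that]
      have domA: "dominant_index r (fps_X ^ (2 * N) * fps_of_poly A) (2 * N + a)"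
        "v (fps_nth (fps_X ^ (2 * N) * fps_of_poly A) (2 * N + a)) = c"
        using dominant_index_mult[OF dominant_index_fps_X_power RA(2)] r
        by (auto simp: a_def c_def fps_X_power_mult_nth)
      have "v (fps_nth (- (E * g\<^sup>2)) j) * r ^ j
          < v (fps_nth (fps_X ^ (2 * N) * fps_of_poly A) (2 * N + a)) * r ^ (2 * N + a)" for j
      proof -
        have "v (fps_nth (E * g\<^sup>2) j) * r ^ j \<le> \<epsilon> * r ^ (2 * (N + d)) * gauss_norm r (g\<^sup>2)"
          using E_le r g unfolding E_def power2_eq_square[of g]
          by (intro v_mult_nth_le coeff_le_gauss_norm entire_series_mult) auto
        also have "\<dots> = \<epsilon> * (r ^ (2 * d) * (gauss_norm r g)\<^sup>2) * r ^ (2 * N)"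
          using g r by (simp add: power2_eq_square[of g] gauss_norm_mult power2_eq_square power_add)
        also have "\<dots> < c * r ^ a * r ^ (2 * N)"
          using \<epsilon>_less[OF that] r by (intro mult_strict_right_mono) auto
        finally show ?thesis
          unfolding domA(2) by (simp add: power_add ac_simps)
      qed
      from dominant_index_add[OF domA(1) this r(3)]
      have UV_dom: "dominant_index r (U * V) (2 * N + a)" "v (fps_nth (U * V) (2 * N + a)) = c"
        unfolding UV domA(2) by blast+
      then have "U \<noteq> 0" "V \<noteq> 0" by (auto simp: dominant_index_def)
      then obtain n m where nm: "dominant_index r U n" "dominant_index r V m"
        using dominant_index_exists UV_entire r(3) by metis
      then have "n + m = 2 * N + a"
        using dominant_index_mult(1) dominant_index_unique UV_dom(1) r(3) by blast
      then show ?thesis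
        using nm dominant_index_mult(2)[OF nm r(3)] UV_dom(2) by auto
    qed
    have inT: "r1 \<in> T" "2 * r1 \<in> T" "r2 \<in> T" by (auto simp: T_def)
    obtain n m where nm: "dominant_index r1 U n" "dominant_index r1 V m" "n + m = 2 * N + a"
        "v (fps_nth U n) * v (fps_nth V m) = c"
      using dom[OF inT(1)] by blast
    obtain n' m' where nm': "dominant_index r2 U n'" "dominant_index r2 V m'" "n' + m' = 2 * N + a"
      using dom[OF inT(3)] by blast
    \<comment> \<open>Both indices can only grow, while their sum is the same at the two radii.\<close>
    have "n \<le> n'" "m \<le> m'"
      using nm nm' r1 r2 by (auto intro!: dominant_index_mono)
    then have eq: "n' = n" "m' = m"
      using nm(3) nm'(3) by linarith+
    have le: "n \<le> N + K" "m \<le> N + K"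
    proof -
      show "n \<le> N + K"
        using dominant_index_growth_bound[OF nm(1,2) coeff_bound(1) coeff_bound(2) nm(4,3) K] inT r1
        by blast
      show "m \<le> N + K"
        using dominant_index_growth_bound[OF nm(2,1) coeff_bound(2) coeff_bound(1) _ _ K] inT r1 nm(3,4)
        by (simp add: ac_simps)
    qed
    \<comment> \<open>Constancy of the dominant index makes the norm at \<open>r2\<close> exactly \<open>(r2 / r1)\<^sup>i\<close> times that at \<open>r1\<close>.\<close>
    have step: "v (fps_nth W j) * r2 ^ j \<le> r2 ^ N * (\<mu> r1 / r1 ^ K * r2 ^ K)"
      if W: "dominant_index r2 W i" "i \<le> N + K" "v (fps_nth W i) * r1 ^ i \<le> r1 ^ N * \<mu> r1" for W i j
    proof -
      have r2pos: "r2 > 0" using r1 r2 by linarith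
      have "v (fps_nth W j) * r2 ^ j \<le> v (fps_nth W i) * r2 ^ i"
        using W(1) by (simp add: dominant_index_def)
      also have "\<dots> = v (fps_nth W i) * r1 ^ i * (r2 / r1) ^ i"
        using r1 by (simp add: power_divide)
      also have "\<dots> \<le> v (fps_nth W i) * r1 ^ i * (r2 / r1) ^ (N + K)"
        using r1 r2 W(2) by (intro mult_left_mono power_increasing) (auto simp: field_simps)
      also have "\<dots> \<le> r1 ^ N * \<mu> r1 * (r2 / r1) ^ (N + K)"
        using W(3) r1 r2pos by (intro mult_right_mono) auto
      also have "\<dots> = r2 ^ N * (\<mu> r1 / r1 ^ K * r2 ^ K)"
        using r1 by (simp add: power_divide power_add)
      finally show ?thesis .
    qed
    have r2pos: "r2 > 0" using r1 r2 by linarith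
    let ?B = "\<mu> r1 / r1 ^ K * r2 ^ K"
    have "fps_nth (U + V) (N + k) = 2 * fps_nth P k"
      unfolding U_def V_def fps_add_nth fps_sub_nth fps_X_power_mult_nth by simp
    then have "v 2 * v (fps_nth P k) \<le> max (v (fps_nth U (N + k))) (v (fps_nth V (N + k)))"
      using v_add_le_max[of "fps_nth U (N + k)" "fps_nth V (N + k)"] by (simp flip: v_mult)
    then have "v 2 * v (fps_nth P k) * r2 ^ (N + k)
        \<le> max (v (fps_nth U (N + k))) (v (fps_nth V (N + k))) * r2 ^ (N + k)"
      using r2pos by (intro mult_right_mono) auto
    also have "\<dots> \<le> r2 ^ N * ?B"
      using step[of U n "N + k"] step[of V m "N + k"] nm'(1,2) le coeff_bound inT(1)
      unfolding eq by (simp add: max_def)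
    also have "v 2 * v (fps_nth P k) * r2 ^ (N + k) = r2 ^ N * (v 2 * (v (fps_nth P k) * r2 ^ k))"
      by (simp add: power_add)
    finally have "v 2 * (v (fps_nth P k) * r2 ^ k) \<le> ?B"
      using r2pos by (subst (asm) mult_le_cancel_left_pos) auto
    then have "v (fps_nth P k) * r2 ^ k \<le> ?B / v 2"
      by (subst pos_le_divide_eq) (simp_all add: mult.commute)
    then show "v (fps_nth P k) * r2 ^ k \<le> \<mu> r1 / r1 ^ K / v 2 * r2 ^ K"
      by simp
  qed
qed

text \<open>
  Multiplying the equation by \<open>A\<close> turns it into the Pell equation for \<open>P = A f\<close> and \<open>D = - A B\<close>.
\<close>

theorem quadratic_equation_polynomial:
  assumes f: "entire_series f" and g: "entire_series g" and A: "A \<noteq> 0" and B: "B \<noteq> 0"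
    and eq: "fps_of_poly A * f\<^sup>2 + fps_of_poly B * g\<^sup>2 = 1"
    and squares: "\<And>x \<epsilon>. \<epsilon> > 0 \<Longrightarrow> \<exists>l. v (l\<^sup>2 - x) < \<epsilon>"
  shows "f \<in> range fps_of_poly"
proof -
  define P where "P = fps_of_poly A * f"
  define D where "D = - (A * B)"
  have P: "entire_series P"
    unfolding P_def by (intro entire_series_mult f entire_series_poly)
  have D: "D \<noteq> 0" using A B by (simp add: D_def)
  have "P\<^sup>2 - fps_of_poly D * g\<^sup>2 = fps_of_poly A * (fps_of_poly A * f\<^sup>2 + fps_of_poly B * g\<^sup>2)"
    by (simp add: P_def D_def fps_of_poly_mult fps_of_poly_uminus algebra_simps power2_eq_square)
  then have pell: "P\<^sup>2 - fps_of_poly D * g\<^sup>2 = fps_of_poly A"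
    by (simp add: eq)
  have "P \<in> range fps_of_poly"
  proof (cases "even (degree D)")
    case True
    then obtain d where "degree D = 2 * d" by blast
    then show ?thesis
      using pell_polynomial_even[OF P g D _ A pell squares] by blast
  qed (use pell_polynomial_odd[OF P g _ pell] in blast)
  then show ?thesis
    using polynomial_if_mult_polynomial[OF f A] unfolding P_def by blast
qed

end

section \<open>The field of complex \<open>p\<close>-adic numbers\<close>

text \<open>
  The binomial theorem bounds \<open>w (x + y)\<^sup>n\<close> by \<open>(n + 1) (max (w x) (w y))\<^sup>n\<close>, and the factor
  \<open>n + 1\<close> is too small to make up for a ratio of the bases greater than \<open>1\<close>.
\<close>

lemma ultrametric_if_bounded_on_nat:
  fixes w :: "'a::field \<Rightarrow> real"
  assumes zero: "w 0 = 0" and pos: "\<And>x. x \<noteq> 0 \<Longrightarrow> w x > 0"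
    and mult: "\<And>x y. w (x * y) = w x * w y" and triangle: "\<And>x y. w (x + y) \<le> w x + w y"
    and nat: "\<And>n. w (of_nat n) \<le> 1"
  shows "w (x + y) \<le> max (w x) (w y)"
proof (rule ccontr)
  assume contr: "\<not> ?thesis"
  define m where "m = max (w x) (w y)"
  have nonneg: "w z \<ge> 0" for z
    using pos[of z] zero by (cases "z = 0") auto
  have m: "m > 0"
  proof (rule ccontr)
    assume "\<not> m > 0"
    then have "w x = 0" "w y = 0"
      using nonneg[of x] nonneg[of y] by (auto simp: m_def)
    then show False
      using contr triangle[of x y] by simp
  qed
  have "w 1 > 0" using pos by simp
  moreover have "w 1 * w 1 = w 1" using mult[of 1 1] by simp
  ultimately have w1: "w 1 = 1" by simp
  have wpow: "w (z ^ n) = w z ^ n" for z n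
    by (induction n) (simp_all add: w1 mult)
  have wsum: "w (sum h I) \<le> (\<Sum>i\<in>I. w (h i))" for h :: "nat \<Rightarrow> 'a" and I
  proof (induction I rule: infinite_finite_induct)
    case (insert i I)
    then show ?case using triangle[of "h i" "sum h I"] by simp
  qed (simp_all add: zero)
  define q where "q = m / w (x + y)"
  have q: "0 < q" "q < 1"
    using contr m by (auto simp: q_def m_def)
  have bound: "1 \<le> (of_nat n + 1) * q ^ n" for n
  proof -
    have "w (x + y) ^ n = w (\<Sum>k\<le>n. of_nat (n choose k) * x ^ k * y ^ (n - k))"
      by (simp add: binomial_ring flip: wpow)
    also have "\<dots> \<le> (\<Sum>k\<le>n. w (of_nat (n choose k) * x ^ k * y ^ (n - k)))"
      by (rule wsum)
    also have "\<dots> \<le> (\<Sum>k\<le>n. m ^ n)"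
    proof (rule sum_mono)
      fix k assume k: "k \<in> {..n}"
      have "w (of_nat (n choose k)) * w x ^ k * w y ^ (n - k) \<le> 1 * m ^ k * m ^ (n - k)"
        using nonneg nat m by (intro mult_mono power_mono) (auto simp: m_def)
      also have "\<dots> = m ^ n"
        using k by (simp flip: power_add)
      finally show "w (of_nat (n choose k) * x ^ k * y ^ (n - k)) \<le> m ^ n"
        by (simp add: mult wpow)
    qed
    also have "\<dots> = (of_nat n + 1) * m ^ n"
      by (simp add: distrib_right)
    finally have "w (x + y) ^ n \<le> (of_nat n + 1) * m ^ n" .
    then show ?thesis
      using contr m by (simp add: q_def power_divide pos_le_divide_eq m_def)
  qed
  have "(\<lambda>n. of_nat n * q ^ n + q ^ n) \<longlonglongrightarrow> 0 + 0"
    using q by (intro tendsto_add powser_times_n_limit_0 LIMSEQ_power_zero) auto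
  then have "(\<lambda>n. (of_nat n + 1) * q ^ n) \<longlonglongrightarrow> 0"
    by (simp add: distrib_right)
  then have "1 \<le> (0::real)"
    using bound by (intro LIMSEQ_le_const) auto
  then show False by simp
qed

lemma abs_val_0: "abs_val (0::'a::valued_field_char_0) = 0"
  using dist_abs_val[of "0::'a" 0] by simp

lemma complex_padics_nonarchimedean:
  assumes "prime p" and Cp: "is_complex_padics TYPE('a::valued_field_char_0) p"
  shows "nonarchimedean_absolute_value (abs_val :: 'a \<Rightarrow> real)"
proof -
  have abs_dist: "abs_val x = dist x 0" for x :: 'a
    by (simp add: dist_abs_val)
  have minus: "abs_val (- y) = abs_val y" for y :: 'a
    using dist_commute[of 0 y] by (simp add: dist_abs_val)
  have "p \<ge> 1" using prime_ge_1_nat[OF assms(1)] .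
  have nat: "abs_val (of_nat n :: 'a) \<le> 1" for n
  proof (cases "n = 0")
    case False
    have "abs_val (of_nat n :: 'a) = padic_abs p (of_nat n)"
      using Cp unfolding is_complex_padics_def by (metis of_rat_of_nat_eq)
    also have "\<dots> = real p powi (- int (multiplicity (int p) (int n)))"
      using False by (simp add: padic_abs_def padic_ord_def)
    also have "\<dots> \<le> 1"
      using \<open>p \<ge> 1\<close> by (simp add: power_int_minus inverse_le_1_iff)
    finally show ?thesis .
  qed (simp add: abs_val_0)
  show ?thesis
  proof
    show "abs_val (x + y) \<le> max (abs_val x) (abs_val y)" for x y :: 'a
    proof (rule ultrametric_if_bounded_on_nat)
      show "abs_val (x + y) \<le> abs_val x + abs_val y" for x y :: 'a
        using dist_triangle[of x "- y" 0] by (simp add: dist_abs_val minus)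
      show "abs_val z > 0" if "z \<noteq> 0" for z :: 'a
        using that by (simp add: abs_dist)
    qed (simp_all add: abs_val_0 abs_val_mult nat)
    show "abs_val x = 0 \<longleftrightarrow> x = 0" "abs_val x \<ge> 0" for x :: 'a
      by (simp_all add: abs_dist)
  qed (rule abs_val_mult)
qed

text \<open>
  Every element is a limit of elements of the dense algebraic closure of the \<open>p\<close>-adic numbers, and
  these have square roots.
\<close>

lemma complex_padics_approximate_square_root:
  assumes Cp: "is_complex_padics TYPE('a::valued_field_char_0) p" and "\<epsilon> > 0"
  shows "\<exists>l. abs_val (l\<^sup>2 - x :: 'a) < \<epsilon>"
proof -
  obtain Qp L :: "'a set" where L: "algebraic_closure_of L Qp" "completion_of UNIV L"
    using Cp unfolding is_complex_padics_def by blast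
  have "x \<in> closure L"
    using L(2) by (auto simp: completion_of_def)
  then obtain y where y: "y \<in> L" "dist y x < \<epsilon>"
    using \<open>\<epsilon> > 0\<close> by (auto simp: closure_approachable)
  have L_field: "0 \<in> L" "1 \<in> L" "- y \<in> L"
    using L(1) y(1) by (auto simp: algebraic_closure_of_def is_subfield_def)
  have "poly_over L [:- y, 0, 1:]"
    using L_field by (auto simp: poly_over_def coeff_pCons split: nat.split)
  moreover have "degree [:- y, 0, 1:] > 0" by simp
  ultimately obtain l where "poly [:- y, 0, 1:] l = 0"
    using L(1) unfolding algebraic_closure_of_def by blast
  then have "l\<^sup>2 = y"
    by (simp add: power2_eq_square)
  then show ?thesis
    using y(2) by (auto simp: dist_abs_val)
qed

text \<open>
  The powers of \<open>1/p\<close> have arbitrarily large absolute value, and at each of them the terms of the convergent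
  series are bounded.
\<close>

lemma complex_padics_entire_series:
  assumes "prime p" and Cp: "is_complex_padics TYPE('a::valued_field_char_0) p"
    and f: "entire_fps (f :: 'a fps)"
  shows "nonarchimedean_absolute_value.entire_series abs_val f"
proof -
  interpret nonarchimedean_absolute_value "abs_val :: 'a \<Rightarrow> real"
    using assms by (intro complex_padics_nonarchimedean)
  have p: "p > 1" using assms(1) prime_gt_1_nat by blast
  have p_abs: "abs_val (of_nat p :: 'a) = 1 / real p"
  proof -
    have "abs_val (of_nat p :: 'a) = padic_abs p (of_nat p)"
      using Cp unfolding is_complex_padics_def by (metis of_rat_of_nat_eq)
    also have "\<dots> = real p powi (-1)"
      using p multiplicity_self[of "int p"] by (simp add: padic_abs_def padic_ord_def)
    finally show ?thesis by (simp add: power_int_minus divide_inverse)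
  qed
  show ?thesis
    unfolding entire_series_def
  proof (intro allI impI)
    fix r :: real assume r: "r > 0"
    obtain k where k: "r < real p ^ k"
      using real_arch_pow[of "real p" r] p by auto
    define x where "x = (inverse (of_nat p) :: 'a) ^ k"
    have "abs_val (inverse (of_nat p) :: 'a) * abs_val (of_nat p :: 'a) = 1"
      using p by (simp flip: abs_val_mult)
    then have "abs_val (inverse (of_nat p) :: 'a) = real p"
      using p by (simp add: p_abs field_simps)
    then have x: "abs_val x = real p ^ k"
      by (simp add: x_def v_power)
    define s where "s n = (\<Sum>i<n. fps_nth f i * x ^ i)" for n
    obtain l where "s \<longlonglongrightarrow> l"
      using f unfolding entire_fps_def summable_def sums_def s_def by blast
    then have "(\<lambda>n. dist (s (Suc n)) (s n)) \<longlonglongrightarrow> dist l l"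
      by (intro tendsto_dist LIMSEQ_Suc)
    then have "(\<lambda>n. abs_val (fps_nth f n * x ^ n)) \<longlonglongrightarrow> 0"
      by (simp add: s_def dist_abs_val)
    then have "bounded (range (\<lambda>n. abs_val (fps_nth f n * x ^ n)))"
      by (rule convergent_imp_bounded)
    then obtain M where M: "\<And>n. abs_val (fps_nth f n * x ^ n) \<le> M"
      by (auto simp: bounded_iff)
    have "abs_val (fps_nth f n) * r ^ n \<le> M" for n
    proof -
      have "abs_val (fps_nth f n) * r ^ n \<le> abs_val (fps_nth f n) * abs_val x ^ n"
        using r k x by (intro mult_left_mono power_mono) auto
      also have "\<dots> = abs_val (fps_nth f n * x ^ n)"
        by (simp add: v_mult v_power)
      finally show ?thesis using M[of n] by linarith
    qed
    then show "\<exists>M. \<forall>n. abs_val (fps_nth f n) * r ^ n \<le> M" by blast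
  qed
qed

theorem theorem1p2:
  fixes p :: nat
    and A B :: "'a::valued_field_char_0 poly"
    and f g :: "'a fps"
  assumes "prime p"
    and "is_complex_padics TYPE('a) p"
    and "\<And>i. algebraic (coeff A i)" and "\<And>i. algebraic (coeff B i)"
    and "A \<noteq> 0" and "B \<noteq> 0"
    and "entire_fps f" and "entire_fps g"
    and "fps_of_poly A * f\<^sup>2 + fps_of_poly B * g\<^sup>2 = 1"
    and "fps_nth g 0 \<noteq> 0"
    and "\<And>i::nat. real i \<le> real (degree A + degree B) / 2 - 1
           \<Longrightarrow> algebraic (fps_nth ((fps_deriv ^^ i) f) 0)"
    and "\<And>i::nat. real i < real (degree A + degree B) / 2 - 1
           \<Longrightarrow> algebraic (fps_nth ((fps_deriv ^^ i) g) 0)"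
  shows "f \<in> range fps_of_poly \<and> g \<in> range fps_of_poly"
proof -
  interpret nonarchimedean_absolute_value "abs_val :: 'a \<Rightarrow> real"
    using assms(1,2) by (rule complex_padics_nonarchimedean)
  have entire: "entire_series f" "entire_series g"
    using complex_padics_entire_series[OF assms(1,2)] assms(7,8) by blast+
  have swapped: "fps_of_poly B * g\<^sup>2 + fps_of_poly A * f\<^sup>2 = 1"
    using assms(9) by (simp add: add.commute)
  note squares = complex_padics_approximate_square_root[OF assms(2)]
  show ?thesis
    using quadratic_equation_polynomial[OF entire assms(5,6,9) squares]
      quadratic_equation_polynomial[OF entire(2,1) assms(6,5) swapped squares] by blast
qed

end
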